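(* Let $X$ be a Banach space. Then $\zeta_X\leqslant \xi_X$.
   Context: For a Banach space $X$, $B_R(c)$ denotes the closed ball with center $c$ and radius $R>0$, $o$ is the origin, $\operatorname{co} D$ is the convex hull of $D$, and $\rho(x,A)=\inf_{a\in A}\|x-a\|$ is the distance from the point $x$ to the set $A$. The deviation from $A$ to $B$ is $h^{+}(A,B)=\sup_{x\in A}\rho(x,B)$. The CHD-constant (convex hull deviation constant) of $X$ is $\zeta_X=\sup h^{+}(\operatorname{co} D, D)$, where the supremum is over all (nonempty) sets $D\subset B_1(o)$. For $p\in X^*$ and $x\in X$, $\langle p,x\rangle$ is the value of the functional $p$ at $x$. For $x \in X$ put $J_1(x)=\{p\in X^*: \langle p,x\rangle=\|p\|\cdot\|x\|=\|x\|\}$, and define $$\xi_X=\sup_{\|x\|=1,\ \|y\|=1}\ \sup_{p\in J_1(y)}\|x-\langle p,x\rangle y\|.$$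
   Formalization: The formal theorem assumes X is not one-dimensional; the claim fails in every one-dimensional space: for X = ℝ, D = {−1, 1} gives ζ_X ≥ 1, while x = ±y for unit vectors forces ξ_X = 0. *)

theory Defs
  imports "HOL-Analysis.Analysis"
begin

text \<open>
  Suprema of nonnegative quantities are taken in \<^typ>\<open>ennreal\<close>, so that no boundedness side
  condition is needed and the supremum of the empty family is 0.  The topological dual is the
  type of bounded linear maps into the reals.
\<close>

definition deviation :: "'a::metric_space set \<Rightarrow> 'a set \<Rightarrow> ennreal" where
  "deviation A B = (SUP x\<in>A. ennreal (infdist x B))"

text \<open>
  Nonemptiness of \<open>D\<close> also keeps \<^const>\<open>infdist\<close> away from its default value on the empty set.
\<close>

definition CHD_constant :: "'a::real_normed_vector itself \<Rightarrow> ennreal" where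
  "CHD_constant _ =
     (SUP D\<in>{D :: 'a set. D \<noteq> {} \<and> D \<subseteq> cball 0 1}. deviation (convex hull D) D)"

definition J1 :: "'a::real_normed_vector \<Rightarrow> ('a \<Rightarrow>\<^sub>L real) set" where
  "J1 x = {p. blinfun_apply p x = norm p * norm x \<and> norm p * norm x = norm x}"

definition xi_constant :: "'a::real_normed_vector itself \<Rightarrow> ennreal" where
  "xi_constant _ =
     (SUP (x, y)\<in>{(x :: 'a, y). norm x = 1 \<and> norm y = 1}.
        SUP p\<in>J1 y. ennreal (norm (x - blinfun_apply p x *\<^sub>R y)))"

end

theory Submission imports Defs
begin

text \<open>
  Let \<open>x\<close> be a nonzero point of the convex hull of \<open>D\<close>, put \<open>y = x / \<parallel>x\<parallel>\<close> and take a functional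
  \<open>p\<close> of norm one with \<open>p y = 1\<close>.  The half-space \<open>p \<ge> p x = \<parallel>x\<parallel>\<close> contains \<open>x\<close>, hence it also
  contains a point \<open>d\<close> of \<open>D\<close>, since otherwise the convex hull of \<open>D\<close> would lie in the complementary
  half-space.  Along the ray spanned by \<open>y\<close> consider the convex function
  \<open>g t = \<parallel>d - t y\<parallel>\<close>.  It satisfies \<open>g 0 = \<parallel>d\<parallel> \<le> 1\<close> and \<open>g \<parallel>x\<parallel> = \<parallel>d - x\<parallel>\<close>.  If \<open>\<parallel>d - x\<parallel> > 1\<close>, then \<open>g\<close>
  has increased on the way from \<open>0\<close> to \<open>\<parallel>x\<parallel>\<close>, so by convexity its value at the later time
  \<open>p d \<ge> \<parallel>x\<parallel>\<close> is at least \<open>\<parallel>d - x\<parallel>\<close>.  Thus \<open>\<parallel>d - x\<parallel> \<le> \<parallel>d - (p d) y\<parallel>\<close>; this expression is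
  homogeneous in \<open>d\<close>, and normalising \<open>d\<close> only enlarges it, which bounds it by \<open>\<xi>\<close>
  (lemma \<open>norm_residual_le_xi\<close>).  If \<open>\<parallel>d - x\<parallel> \<le> 1\<close>, the bound follows from \<open>\<xi> \<ge> 1\<close>: outside
  dimension one \<open>p\<close> has a unit vector in its kernel (lemma \<open>one_le_xi\<close>).  The same bound \<open>\<xi> \<ge> 1\<close>
  settles \<open>x = 0\<close>, which is within distance one of every point of \<open>D\<close>; only in the zero space does
  \<open>\<xi> \<ge> 1\<close> fail, and there \<open>0\<close> itself is the only possible point of \<open>D\<close>.

  The functional \<open>p\<close> comes from the Hahn--Banach theorem, obtained here in the form that a
  minimal sublinear functional is linear.
\<close>

section \<open>Minimal sublinear functionals and norming functionals\<close>

definition sublinear :: "('a::real_vector \<Rightarrow> real) \<Rightarrow> bool" where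
  "sublinear q \<longleftrightarrow>
     (\<forall>x y. q (x + y) \<le> q x + q y) \<and> (\<forall>c x. 0 \<le> c \<longrightarrow> q (c *\<^sub>R x) \<le> c * q x)"

lemma sublinear_add: "sublinear q \<Longrightarrow> q (x + y) \<le> q x + q y"
  by (simp add: sublinear_def)

lemma sublinear_zero:
  assumes "sublinear q" shows "q 0 = 0"
proof -
  have "q (0 *\<^sub>R 0) \<le> 0 * q 0"
    using assms unfolding sublinear_def by blast
  moreover have "q (0 + 0) \<le> q 0 + q 0"
    using assms by (rule sublinear_add)
  ultimately show ?thesis by simp
qed

lemma sublinear_scale:
  assumes "sublinear q" "0 \<le> c" shows "q (c *\<^sub>R x) = c * q x"
proof (cases "c = 0")
  case True
  then show ?thesis using sublinear_zero[OF assms(1)] by simp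
next
  case False
  with assms have "c > 0" by simp
  have "q ((1 / c) *\<^sub>R c *\<^sub>R x) \<le> (1 / c) * q (c *\<^sub>R x)"
    using assms unfolding sublinear_def by (meson divide_nonneg_nonneg zero_le_one)
  then have "c * q x \<le> q (c *\<^sub>R x)"
    using \<open>c > 0\<close> by (simp add: field_simps)
  moreover have "q (c *\<^sub>R x) \<le> c * q x"
    using assms by (simp add: sublinear_def)
  ultimately show ?thesis by simp
qed

lemma sublinear_ge_minus:
  assumes "sublinear q" shows "- q (- x) \<le> q x"
  using sublinear_add[OF assms, of x "- x"] sublinear_zero[OF assms] by simp

lemma sublinear_norm: "sublinear norm"
  by (auto simp: sublinear_def norm_triangle_ineq)

text \<open>
  Pointwise infima of sublinear functionals are in general not subadditive.  The two exchange
  conditions make them so; they hold both for a chain of sublinear functionals and for the family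
  \<open>x \<mapsto> q (x + t a) - t q a\<close> with \<open>t \<ge> 0\<close>, whose members need not be sublinear.
\<close>

lemma sublinear_INF:
  fixes f :: "'i \<Rightarrow> 'a::real_vector \<Rightarrow> real"
  assumes ne: "I \<noteq> {}"
    and bdd: "\<And>x. bdd_below ((\<lambda>i. f i x) ` I)"
    and add: "\<And>i j x y. i \<in> I \<Longrightarrow> j \<in> I \<Longrightarrow> \<exists>k\<in>I. f k (x + y) \<le> f i x + f j y"
    and scale: "\<And>i c x. i \<in> I \<Longrightarrow> 0 \<le> c \<Longrightarrow> \<exists>k\<in>I. f k (c *\<^sub>R x) \<le> c * f i x"
  shows "sublinear (\<lambda>x. INF i\<in>I. f i x)"
proof -
  define u where "u = (\<lambda>x. INF i\<in>I. f i x)"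
  have u_le: "u x \<le> f i x" if "i \<in> I" for i x
    unfolding u_def using bdd that by (rule cINF_lower)
  have le_u: "b \<le> u x" if "\<And>i. i \<in> I \<Longrightarrow> b \<le> f i x" for b x
    unfolding u_def using ne that by (rule cINF_greatest)
  have "u (x + y) \<le> u x + u y" for x y
  proof -
    have *: "u (x + y) \<le> f i x + f j y" if "i \<in> I" "j \<in> I" for i j
      using add[OF that] u_le order_trans by blast
    have "u (x + y) - f j y \<le> u x" if "j \<in> I" for j
      by (rule le_u) (use * that in \<open>simp add: algebra_simps\<close>)
    then have "u (x + y) - u x \<le> u y"
      by (intro le_u) (simp add: algebra_simps)
    then show ?thesis by simp
  qed
  moreover have "u (c *\<^sub>R x) \<le> c * u x" if "0 \<le> c" for c x
  proof -
    have *: "u (c *\<^sub>R x) \<le> c * f i x" if "i \<in> I" for i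
      using scale[OF that \<open>0 \<le> c\<close>] u_le order_trans by blast
    show ?thesis
    proof (cases "c = 0")
      case True
      then show ?thesis using * ne by auto
    next
      case False
      with that have "c > 0" by simp
      then have "u (c *\<^sub>R x) / c \<le> u x"
        by (intro le_u) (use * in \<open>simp add: field_simps\<close>)
      then show ?thesis using \<open>c > 0\<close> by (simp add: field_simps)
    qed
  qed
  ultimately show ?thesis
    unfolding u_def sublinear_def by blast
qed

lemma ex_minimal_sublinear:
  assumes N: "sublinear (N :: 'a::real_vector \<Rightarrow> real)"
  obtains q where "sublinear q" "q \<le> N" "\<And>r. sublinear r \<Longrightarrow> r \<le> q \<Longrightarrow> r = q"
proof -
  define A where "A = {q. sublinear q \<and> q \<le> N}"
  have "\<exists>m\<in>A. \<forall>a\<in>A. a \<le> m \<longrightarrow> a = m"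
  proof (rule predicate_Zorn[where P = "\<lambda>f g. g \<le> f"])
    show "partial_order_on A (relation_of (\<lambda>f g. g \<le> f) A)"
      by (rule partial_order_on_relation_ofI) auto
  next
    fix C assume C: "C \<in> Chains (relation_of (\<lambda>f g :: 'a \<Rightarrow> real. g \<le> f) A)"
    then have CA: "C \<subseteq> A" and lin: "\<And>f g. f \<in> C \<Longrightarrow> g \<in> C \<Longrightarrow> f \<le> g \<or> g \<le> f"
      by (auto simp: Chains_def relation_of_def)
    show "\<exists>u\<in>A. \<forall>a\<in>C. u \<le> a"
    proof (cases "C = {}")
      case True
      then show ?thesis using N by (auto simp: A_def)
    next
      case False
      have sub: "sublinear q" and le: "q x \<le> N x" if "q \<in> C" for q x
        using that CA by (auto simp: A_def le_fun_def)
      have bdd: "bdd_below ((\<lambda>q. q x) ` C)" for x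
      proof (rule bdd_belowI2)
        fix q assume "q \<in> C"
        then show "- N (- x) \<le> q x"
          using sublinear_ge_minus[OF sub, of q x] le[of q "- x"] by simp
      qed
      define u where "u = (\<lambda>x. INF q\<in>C. q x)"
      have "sublinear u"
        unfolding u_def
      proof (rule sublinear_INF[OF False bdd])
        fix q r x y assume qr: "q \<in> C" "r \<in> C"
        \<comment> \<open>the smaller of \<open>q\<close> and \<open>r\<close> serves both arguments\<close>
        from lin[OF qr] show "\<exists>k\<in>C. k (x + y) \<le> q x + r y"
        proof
          assume "q \<le> r"
          then show ?thesis
            using sublinear_add[OF sub[OF qr(1)], of x y] le_funD[of q r y] qr
            by (intro bexI[of _ q]) auto
        next
          assume "r \<le> q"
          then show ?thesis
            using sublinear_add[OF sub[OF qr(2)], of x y] le_funD[of r q x] qr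
            by (intro bexI[of _ r]) auto
        qed
      next
        fix q c x assume "q \<in> C" "(0::real) \<le> c"
        then show "\<exists>k\<in>C. k (c *\<^sub>R x) \<le> c * q x"
          using sublinear_scale[OF sub] by (intro bexI[of _ q]) auto
      qed
      moreover have lower: "u \<le> q" if "q \<in> C" for q
        unfolding u_def le_fun_def using cINF_lower[OF bdd that] by blast
      moreover obtain q where "q \<in> C" using False by blast
      ultimately show ?thesis
        using CA by (auto simp: A_def intro!: bexI[of _ u] intro: order_trans)
    qed
  qed
  then obtain m where m: "sublinear m" "m \<le> N" "\<And>a. a \<in> A \<Longrightarrow> a \<le> m \<Longrightarrow> a = m"
    by (auto simp: A_def)
  show thesis
  proof (rule that[OF m(1,2)])
    fix r assume "sublinear r" "r \<le> m"
    with m(2) show "r = m"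
      by (intro m(3)) (auto simp: A_def intro: order_trans)
  qed
qed

text \<open>
  For sublinear \<open>q\<close> this is the largest sublinear functional below \<open>q\<close> that takes the value \<open>- q a\<close>
  at \<open>- a\<close>, as every linear functional below \<open>q\<close> with value \<open>q a\<close> at \<open>a\<close> does.
\<close>

definition linearize_along :: "('a::real_vector \<Rightarrow> real) \<Rightarrow> 'a \<Rightarrow> 'a \<Rightarrow> real" where
  "linearize_along q a x = (INF t\<in>{0..}. q (x + t *\<^sub>R a) - t * q a)"

lemma linearize_along_bdd:
  assumes "sublinear q"
  shows "bdd_below ((\<lambda>t. q (x + t *\<^sub>R a) - t * q a) ` {0..})"
proof (rule bdd_belowI2)
  fix t :: real assume "t \<in> {0..}"
  then have "t * q a = q (t *\<^sub>R a)"
    using sublinear_scale[OF assms] by simp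
  also have "\<dots> \<le> q (x + t *\<^sub>R a) + q (- x)"
    using sublinear_add[OF assms, of "x + t *\<^sub>R a" "- x"] by simp
  finally show "- q (- x) \<le> q (x + t *\<^sub>R a) - t * q a" by simp
qed

lemma linearize_along_le:
  assumes "sublinear q" "0 \<le> t"
  shows "linearize_along q a x \<le> q (x + t *\<^sub>R a) - t * q a"
  unfolding linearize_along_def
  by (rule cINF_lower[OF linearize_along_bdd[OF assms(1)]]) (use assms in simp)

lemma sublinear_linearize_along:
  assumes q: "sublinear q"
  shows "sublinear (linearize_along q a)"
  unfolding linearize_along_def [abs_def]
proof (rule sublinear_INF[OF _ linearize_along_bdd[OF q]])
  fix s t :: real and x y assume "s \<in> {0..}" "t \<in> {0..}"
  moreover have "q (x + y + (s + t) *\<^sub>R a) \<le> q (x + s *\<^sub>R a) + q (y + t *\<^sub>R a)"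
    using sublinear_add[OF q, of "x + s *\<^sub>R a" "y + t *\<^sub>R a"]
    by (simp add: algebra_simps)
  ultimately show "\<exists>k\<in>{0..}. q (x + y + k *\<^sub>R a) - k * q a
      \<le> (q (x + s *\<^sub>R a) - s * q a) + (q (y + t *\<^sub>R a) - t * q a)"
    by (intro bexI[of _ "s + t"]) (auto simp: algebra_simps)
next
  fix t c :: real and x assume "t \<in> {0..}" "0 \<le> c"
  moreover from this have "q (c *\<^sub>R x + (c * t) *\<^sub>R a) = c * q (x + t *\<^sub>R a)"
    using sublinear_scale[OF q, of c "x + t *\<^sub>R a"] by (simp add: scaleR_add_right)
  ultimately show "\<exists>k\<in>{0..}. q (c *\<^sub>R x + k *\<^sub>R a) - k * q a \<le> c * (q (x + t *\<^sub>R a) - t * q a)"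
    by (intro bexI[of _ "c * t"]) (auto simp: algebra_simps)
qed simp

text \<open>
  Minimality forces \<open>linearize_along q a = q\<close>, so \<open>q\<close> is superadditive as well.
\<close>

lemma minimal_sublinear_linear:
  assumes q: "sublinear q" and min: "\<And>r. sublinear r \<Longrightarrow> r \<le> q \<Longrightarrow> r = q"
  shows "linear q"
proof -
  have add: "q (x + a) = q x + q a" for x a
  proof -
    have "linearize_along q a \<le> q"
      using linearize_along_le[OF q, of 0] by (simp add: le_fun_def)
    then have "linearize_along q a = q"
      by (rule min[OF sublinear_linearize_along[OF q]])
    then have "q x \<le> q (x + a) - q a"
      using linearize_along_le[OF q, of 1 a x] by simp
    then show ?thesis
      using sublinear_add[OF q, of x a] by simp
  qed
  have neg: "q (- x) = - q x" for x
    using add[of x "- x"] sublinear_zero[OF q] by simp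
  have "q (c *\<^sub>R x) = c * q x" for c x
  proof (cases "0 \<le> c")
    case True
    then show ?thesis by (rule sublinear_scale[OF q])
  next
    case False
    then show ?thesis
      using sublinear_scale[OF q, of "- c" x] neg[of "c *\<^sub>R x"] by simp
  qed
  with add show ?thesis by (intro linearI) auto
qed

text \<open>
  A linear functional \<open>p\<close> below the norm has \<open>p y = \<parallel>y\<parallel>\<close> as soon as \<open>p (- y) \<le> - \<parallel>y\<parallel>\<close>, which is
  guaranteed by starting the minimisation below \<open>linearize_along norm y\<close>.
\<close>

lemma ex_norming_functional:
  fixes y :: "'a::real_normed_vector"
  obtains p :: "'a \<Rightarrow>\<^sub>L real" where "norm p \<le> 1" "blinfun_apply p y = norm y"
proof -
  obtain q where q: "sublinear q" "q \<le> linearize_along norm y"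
    and min: "\<And>r. sublinear r \<Longrightarrow> r \<le> q \<Longrightarrow> r = q"
    using ex_minimal_sublinear[OF sublinear_linearize_along[OF sublinear_norm]] by metis
  have lin: "linear q"
    using q(1) min by (rule minimal_sublinear_linear)
  have q_le: "q x \<le> norm (x + t *\<^sub>R y) - t * norm y" if "0 \<le> t" for x t
    using le_funD[OF q(2), of x] linearize_along_le[OF sublinear_norm that, of y x] by simp
  have le: "q x \<le> norm x" for x
    using q_le[of 0 x] by simp
  have abs: "\<bar>q x\<bar> \<le> norm x" for x
    using le[of x] le[of "- x"] linear_neg[OF lin, of x] by simp
  have "q (- y) \<le> - norm y"
    using q_le[of 1 "- y"] by simp
  then have y: "q y = norm y"
    using le[of y] linear_neg[OF lin, of y] by simp
  have "bounded_linear q"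
    by (rule bounded_linear_intro[where K = 1])
       (use lin abs in \<open>auto simp: linear_add linear_cmul\<close>)
  then have ap: "blinfun_apply (Blinfun q) = q"
    by (rule bounded_linear_Blinfun_apply)
  show thesis
  proof (rule that)
    show "norm (Blinfun q) \<le> 1"
      by (rule norm_blinfun_bound) (use abs ap in auto)
    show "blinfun_apply (Blinfun q) y = norm y"
      using ap y by simp
  qed
qed

lemma J1_nonempty:
  fixes y :: "'a::real_normed_vector"
  shows "J1 y \<noteq> {}"
proof -
  obtain p :: "'a \<Rightarrow>\<^sub>L real" where p: "norm p \<le> 1" "blinfun_apply p y = norm y"
    by (rule ex_norming_functional)
  have "norm y \<le> norm p * norm y"
    using norm_blinfun[of p y] p(2) by simp
  moreover have "norm p * norm y \<le> norm y"
    using p(1) by (simp add: mult_left_le_one_le)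
  ultimately show ?thesis
    using p(2) unfolding J1_def by (intro ex_in_conv[THEN iffD1] exI[of _ p]) simp
qed

section \<open>Lower bounds for the constant xi\<close>

lemma le_xi:
  fixes x y :: "'a::real_normed_vector"
  assumes "norm x = 1" "norm y = 1" "p \<in> J1 y"
  shows "ennreal (norm (x - blinfun_apply p x *\<^sub>R y)) \<le> xi_constant TYPE('a)"
  unfolding xi_constant_def
  by (rule SUP_upper2[of "(x, y)"]) (use assms in \<open>auto intro: SUP_upper\<close>)

lemma norm_residual_le_xi:
  fixes d y :: "'a::real_normed_vector"
  assumes d: "norm d \<le> 1" and y: "norm y = 1" "p \<in> J1 y"
  shows "ennreal (norm (d - blinfun_apply p d *\<^sub>R y)) \<le> xi_constant TYPE('a)"
proof (cases "d = 0")
  case True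
  then show ?thesis by simp
next
  case False
  have "norm (d - blinfun_apply p d *\<^sub>R y) = norm d * norm (sgn d - blinfun_apply p (sgn d) *\<^sub>R y)"
  proof -
    have "d - blinfun_apply p d *\<^sub>R y = norm d *\<^sub>R (sgn d - blinfun_apply p (sgn d) *\<^sub>R y)"
      using False by (simp add: sgn_div_norm blinfun.scaleR_right algebra_simps)
    then show ?thesis by simp
  qed
  also have "\<dots> \<le> norm (sgn d - blinfun_apply p (sgn d) *\<^sub>R y)"
    using d by (simp add: mult_left_le_one_le)
  finally have "ennreal (norm (d - blinfun_apply p d *\<^sub>R y))
      \<le> ennreal (norm (sgn d - blinfun_apply p (sgn d) *\<^sub>R y))"
    by (rule ennreal_leI)
  also have "\<dots> \<le> xi_constant TYPE('a)"
    by (rule le_xi) (use False y in \<open>auto simp: norm_sgn\<close>)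
  finally show ?thesis .
qed

text \<open>
  If the residual \<open>v - (p v) y\<close> vanished for every \<open>v\<close>, the space would be the line through \<open>y\<close>.
  Otherwise a normalised residual is a unit vector in the kernel of \<open>p\<close>, and equals its own residual.
  Since \<open>dim\<close> is \<open>0\<close> for infinite-dimensional spaces, the hypothesis excludes exactly the lines.
\<close>

lemma one_le_xi:
  fixes y :: "'a::real_normed_vector"
  assumes dim: "dim (UNIV :: 'a set) \<noteq> 1" and y: "norm y = 1"
  shows "1 \<le> xi_constant TYPE('a)"
proof -
  obtain p where p: "p \<in> J1 y"
    using J1_nonempty by blast
  have py: "blinfun_apply p y = 1"
    using p y by (simp add: J1_def)
  have "\<exists>v. v \<noteq> blinfun_apply p v *\<^sub>R y"
  proof (rule ccontr)
    assume "\<nexists>v. v \<noteq> blinfun_apply p v *\<^sub>R y"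
    then have "span {y} = UNIV"
      by (auto simp: span_singleton)
    then have "dim (UNIV :: 'a set) = dim {y}"
      by (metis dim_span)
    also have "dim {y} = card {y}"
      by (rule dim_eq_card_independent) (use y in auto)
    finally show False using dim by simp
  qed
  then obtain v where v: "v \<noteq> blinfun_apply p v *\<^sub>R y" ..
  define x where "x = sgn (v - blinfun_apply p v *\<^sub>R y)"
  have "norm x = 1"
    using v by (simp add: x_def norm_sgn)
  moreover have "blinfun_apply p x = 0"
    by (simp add: x_def sgn_div_norm blinfun.scaleR_right blinfun.diff_right py)
  ultimately show ?thesis
    using le_xi[OF _ y p, of x] by simp
qed

section \<open>Points of a convex hull\<close>

lemma convex_hull_functional_ge:
  assumes f: "linear (f :: 'a::real_vector \<Rightarrow> real)" and x: "x \<in> convex hull D"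
  obtains d where "d \<in> D" "f x \<le> f d"
proof -
  have "\<exists>d\<in>D. f x \<le> f d"
  proof (rule ccontr)
    assume "\<not> ?thesis"
    then have "D \<subseteq> f -` {..<f x}" by auto
    moreover have "convex (f -` {..<f x})"
      using f by (rule convex_linear_vimage) simp
    ultimately have "convex hull D \<subseteq> f -` {..<f x}"
      by (rule hull_minimal)
    with x show False by auto
  qed
  then show thesis using that by blast
qed

text \<open>
  Once the norm has increased along a ray, convexity keeps it increasing: \<open>s y\<close> is the
  convex combination of \<open>0\<close> and \<open>t y\<close> with weight \<open>s / t\<close> on the latter.
\<close>

lemma norm_along_ray_mono:
  fixes d y :: "'a::real_normed_vector"
  assumes "0 < s" "s \<le> t" and inc: "norm d \<le> norm (d - s *\<^sub>R y)"
  shows "norm (d - s *\<^sub>R y) \<le> norm (d - t *\<^sub>R y)"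
proof -
  define l where "l = s / t"
  have l: "0 < l" "l \<le> 1" "s = l * t"
    using assms by (auto simp: l_def)
  have "d - s *\<^sub>R y = (1 - l) *\<^sub>R d + l *\<^sub>R (d - t *\<^sub>R y)"
    using l by (simp add: algebra_simps)
  then have "norm (d - s *\<^sub>R y) \<le> norm ((1 - l) *\<^sub>R d) + norm (l *\<^sub>R (d - t *\<^sub>R y))"
    by (metis norm_triangle_ineq)
  also have "\<dots> = (1 - l) * norm d + l * norm (d - t *\<^sub>R y)"
    using l by simp
  also have "\<dots> \<le> (1 - l) * norm (d - s *\<^sub>R y) + l * norm (d - t *\<^sub>R y)"
    using l inc by (simp add: mult_left_mono)
  finally have "l * norm (d - s *\<^sub>R y) \<le> l * norm (d - t *\<^sub>R y)"
    by (simp add: algebra_simps)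
  then show ?thesis using l by simp
qed

lemma ex_dist_le_xi:
  fixes x :: "'a::real_normed_vector"
  assumes dim: "dim (UNIV :: 'a set) \<noteq> 1"
    and D: "D \<subseteq> cball 0 1" and x: "x \<in> convex hull D"
  shows "\<exists>d\<in>D. ennreal (dist x d) \<le> xi_constant TYPE('a)"
proof (cases "x = 0")
  case True
  obtain d where d: "d \<in> D"
    using x by fastforce
  show ?thesis
  proof (cases "d = 0")
    case True
    with d \<open>x = 0\<close> show ?thesis by (intro bexI[of _ d]) auto
  next
    case False
    have "ennreal (dist x d) \<le> 1"
      using \<open>x = 0\<close> d D by auto
    also have "1 \<le> xi_constant TYPE('a)"
      by (rule one_le_xi[OF dim, of "sgn d"]) (use False in \<open>simp add: norm_sgn\<close>)
    finally show ?thesis using d by blast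
  qed
next
  case False
  define y where "y = sgn x"
  have y: "norm y = 1" and x_eq: "x = norm x *\<^sub>R y"
    using False by (auto simp: y_def norm_sgn sgn_div_norm)
  obtain p where p: "p \<in> J1 y"
    using J1_nonempty by blast
  have "blinfun_apply p y = 1"
    using p y by (simp add: J1_def)
  then have px: "blinfun_apply p x = norm x"
    using x_eq by (metis blinfun.scaleR_right mult.right_neutral real_scaleR_def)
  have "linear (blinfun_apply p)"
    by (rule bounded_linear.linear[OF blinfun.bounded_linear_right])
  then obtain d where d: "d \<in> D" "norm x \<le> blinfun_apply p d"
    using convex_hull_functional_ge[OF _ x] px by metis
  have d1: "norm d \<le> 1"
    using d D by auto
  have "ennreal (norm (d - x)) \<le> xi_constant TYPE('a)"
  proof (cases "norm (d - x) \<le> 1")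
    case True
    then have "ennreal (norm (d - x)) \<le> 1" by simp
    also note one_le_xi[OF dim y]
    finally show ?thesis .
  next
    case False
    have "norm (d - norm x *\<^sub>R y) \<le> norm (d - blinfun_apply p d *\<^sub>R y)"
      by (rule norm_along_ray_mono) (use False \<open>x \<noteq> 0\<close> d d1 x_eq in auto)
    then have "ennreal (norm (d - x)) \<le> ennreal (norm (d - blinfun_apply p d *\<^sub>R y))"
      using x_eq by (intro ennreal_leI) simp
    also have "\<dots> \<le> xi_constant TYPE('a)"
      using d1 y p by (rule norm_residual_le_xi)
    finally show ?thesis .
  qed
  with d(1) show ?thesis
    by (auto simp: dist_norm norm_minus_commute)
qed

theorem theorem5:
  assumes "dim (UNIV :: 'a::banach set) \<noteq> 1"
  shows "CHD_constant TYPE('a) \<le> xi_constant TYPE('a)"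
  unfolding CHD_constant_def deviation_def
proof (intro SUP_least)
  fix D :: "'a set" and x
  assume "D \<in> {D. D \<noteq> {} \<and> D \<subseteq> cball 0 1}" "x \<in> convex hull D"
  then obtain d where d: "d \<in> D" "ennreal (dist x d) \<le> xi_constant TYPE('a)"
    using ex_dist_le_xi[OF assms] by blast
  have "ennreal (infdist x D) \<le> ennreal (dist x d)"
    using d(1) by (intro ennreal_leI infdist_le)
  also note d(2)
  finally show "ennreal (infdist x D) \<le> xi_constant TYPE('a)" .
qed

end
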